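(* Consider Case 1 of the problem described in the context (specific heat $c$ unknown; $k,\rho,\ell>0$, $T_m$, $T_0>T_m$, $q_0>0$ given), whose solution for $0<\alpha<1$, under the hypothesis $\frac{k\rho\ell(T_0-T_m)\Gamma(1+\alpha/2)}{q_0^2\Gamma(1-\alpha/2)}<1$, is $c_\alpha=\frac{\ell\Gamma(1+\frac{\alpha}{2})}{(T_0-T_m)\Gamma(1-\frac{\alpha}{2})}\frac{\xi_\alpha}{M_{\alpha/2}(\xi_\alpha)}[1-W(-\xi_\alpha;-\frac{\alpha}{2},1)]$, $T_\alpha(x,t)=T_0-\frac{T_0-T_m}{1-W(-\xi_\alpha;-\frac{\alpha}{2},1)}[1-W(-\frac{x}{\lambda_\alpha t^{\alpha/2}};-\frac{\alpha}{2},1)]$, $s_\alpha(t)=\lambda_\alpha\xi_\alpha t^{\alpha/2}$, $\lambda_\alpha^2=k/(\rho c_\alpha)$, with $\xi_\alpha>0$ the unique solution of $\frac{1-W(-x;-\frac{\alpha}{2},1)}{x}=\frac{k\rho\ell(T_0-T_m)\Gamma(1+\frac{\alpha}{2})}{q_0^2\Gamma^3(1-\frac{\alpha}{2})}\frac{1}{M_{\alpha/2}(x)}$, $x>0$. Then, as $\alpha\to 1^-$, this solution coincides with the following one (the classical case $\alpha=1$): $$s_1(t)=2\lambda_1\mu_1 t^{1/2},\quad T_1(x,t)=T_0-\frac{T_0-T_m}{\operatorname{erf}(\mu_1)}\operatorname{erf}\left(\frac{x}{2\lambda_1 t^{1/2}}\right),$$ $$c_1=\frac{\pi q_0^2}{k\rho(T_0-T_m)^2}\operatorname{erf}^2(\mu_1),\quad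 \lambda_1=\sqrt{\frac{k}{\rho c_1}}=\frac{k(T_0-T_m)}{q_0\sqrt{\pi}\,\operatorname{erf}(\mu_1)},$$ where $\mu_1>0$ is the unique solution of $$\exp(x^2)=\frac{q_0^2\sqrt{\pi}}{k\rho\ell(T_0-T_m)}\,\frac{\operatorname{erf}(x)}{x},\quad x>0;$$ in particular the hypothesis on the data becomes $\frac{k\rho\ell(T_0-T_m)}{2q_0^2}<1$.
   Context: For $0<\alpha<1$ the Caputo derivative is $D^\alpha f(t)=\frac{1}{\Gamma(1-\alpha)}\int_0^t \frac{f'(\tau)}{(t-\tau)^\alpha}d\tau$, and $D^1f=f'$. The Wright function is $W(z;a,b)=\sum_{n\ge0}\frac{z^n}{n!\,\Gamma(na+b)}$ ($a>-1$, $b\in\mathbb{R}$); the Mainardi function is $M_\nu(z)=W(-z;-\nu,1-\nu)$. $\operatorname{erf}(x)=\frac{2}{\sqrt\pi}\int_0^x e^{-u^2}du$. The problem (for $0<\alpha\le 1$): with positive constants $\rho,k,c,\ell$, $\lambda^2=k/(\rho c)$, melting temperature $T_m$, $T_0>T_m$, $q_0>0$, find $s(t)$, $T(x,t)$ and the unknown coefficient with $D^\alpha T=\lambda^2T_{xx}$ in $0<x<s(t)$, $t>0$; $s(0)=0$; $T(x,0)=T(+\infty,t)=T_m$; $T(s(t),t)=T_m$; $-kT_x(s(t),t)=\rho\ell D^\alpha s(t)$; $T(0,t)=T_0$; $kT_x(0,t)=-q_0/t^{\alpha/2}$ for $t>0$. *)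

theory Defs
  imports "HOL-Analysis.Analysis"
begin

text \<open>Wright function W(z;a,b) = sum_n z^n / (n! Gamma(n a + b)); 1/Gamma is rGamma
  (which is 0 at the poles of Gamma, the standard convention).\<close>
definition Wright :: "real \<Rightarrow> real \<Rightarrow> real \<Rightarrow> real" where
  "Wright z a b = (\<Sum>n. z ^ n / fact n * rGamma (real n * a + b))"

definition Mainardi :: "real \<Rightarrow> real \<Rightarrow> real" where
  "Mainardi \<nu> z = Wright (- z) (- \<nu>) (1 - \<nu>)"

definition erf :: "real \<Rightarrow> real" where
  "erf x = 2 / sqrt pi *
     (if 0 \<le> x then integral {0..x} (\<lambda>u. exp (- (u\<^sup>2)))
      else - integral {x..0} (\<lambda>u. exp (- (u\<^sup>2))))"

definition xi_alpha :: "real \<Rightarrow> real \<Rightarrow> real \<Rightarrow> real \<Rightarrow> real \<Rightarrow> real \<Rightarrow> real \<Rightarrow> real" where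
  "xi_alpha k \<rho> L T0 Tm q0 \<alpha> =
     (THE x. 0 < x \<and>
        (1 - Wright (- x) (- \<alpha> / 2) 1) / x =
          k * \<rho> * L * (T0 - Tm) * Gamma (1 + \<alpha> / 2) / (q0\<^sup>2 * Gamma (1 - \<alpha> / 2) ^ 3)
          * (1 / Mainardi (\<alpha> / 2) x))"

definition c_alpha :: "real \<Rightarrow> real \<Rightarrow> real \<Rightarrow> real \<Rightarrow> real \<Rightarrow> real \<Rightarrow> real \<Rightarrow> real" where
  "c_alpha k \<rho> L T0 Tm q0 \<alpha> =
     (let \<xi> = xi_alpha k \<rho> L T0 Tm q0 \<alpha> in
      L * Gamma (1 + \<alpha> / 2) / ((T0 - Tm) * Gamma (1 - \<alpha> / 2))
      * (\<xi> / Mainardi (\<alpha> / 2) \<xi>) * (1 - Wright (- \<xi>) (- \<alpha> / 2) 1))"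

definition lambda_alpha :: "real \<Rightarrow> real \<Rightarrow> real \<Rightarrow> real \<Rightarrow> real \<Rightarrow> real \<Rightarrow> real \<Rightarrow> real" where
  "lambda_alpha k \<rho> L T0 Tm q0 \<alpha> = sqrt (k / (\<rho> * c_alpha k \<rho> L T0 Tm q0 \<alpha>))"

definition s_alpha :: "real \<Rightarrow> real \<Rightarrow> real \<Rightarrow> real \<Rightarrow> real \<Rightarrow> real \<Rightarrow> real \<Rightarrow> real \<Rightarrow> real" where
  "s_alpha k \<rho> L T0 Tm q0 \<alpha> t =
     lambda_alpha k \<rho> L T0 Tm q0 \<alpha> * xi_alpha k \<rho> L T0 Tm q0 \<alpha> * t powr (\<alpha> / 2)"

definition T_alpha :: "real \<Rightarrow> real \<Rightarrow> real \<Rightarrow> real \<Rightarrow> real \<Rightarrow> real \<Rightarrow> real \<Rightarrow> real \<Rightarrow> real \<Rightarrow> real" where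
  "T_alpha k \<rho> L T0 Tm q0 \<alpha> x t =
     T0 - (T0 - Tm) / (1 - Wright (- xi_alpha k \<rho> L T0 Tm q0 \<alpha>) (- \<alpha> / 2) 1)
       * (1 - Wright (- (x / (lambda_alpha k \<rho> L T0 Tm q0 \<alpha> * t powr (\<alpha> / 2)))) (- \<alpha> / 2) 1)"

definition mu_1 :: "real \<Rightarrow> real \<Rightarrow> real \<Rightarrow> real \<Rightarrow> real \<Rightarrow> real \<Rightarrow> real" where
  "mu_1 k \<rho> L T0 Tm q0 =
     (THE x. 0 < x \<and> exp (x\<^sup>2) = q0\<^sup>2 * sqrt pi / (k * \<rho> * L * (T0 - Tm)) * (erf x / x))"

definition c_1 :: "real \<Rightarrow> real \<Rightarrow> real \<Rightarrow> real \<Rightarrow> real \<Rightarrow> real \<Rightarrow> real" where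
  "c_1 k \<rho> L T0 Tm q0 =
     pi * q0\<^sup>2 / (k * \<rho> * (T0 - Tm)\<^sup>2) * (erf (mu_1 k \<rho> L T0 Tm q0))\<^sup>2"

definition lambda_1 :: "real \<Rightarrow> real \<Rightarrow> real \<Rightarrow> real \<Rightarrow> real \<Rightarrow> real \<Rightarrow> real" where
  "lambda_1 k \<rho> L T0 Tm q0 = sqrt (k / (\<rho> * c_1 k \<rho> L T0 Tm q0))"

definition s_1 :: "real \<Rightarrow> real \<Rightarrow> real \<Rightarrow> real \<Rightarrow> real \<Rightarrow> real \<Rightarrow> real \<Rightarrow> real" where
  "s_1 k \<rho> L T0 Tm q0 t = 2 * lambda_1 k \<rho> L T0 Tm q0 * mu_1 k \<rho> L T0 Tm q0 * sqrt t"

definition T_1 :: "real \<Rightarrow> real \<Rightarrow> real \<Rightarrow> real \<Rightarrow> real \<Rightarrow> real \<Rightarrow> real \<Rightarrow> real \<Rightarrow> real" where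
  "T_1 k \<rho> L T0 Tm q0 x t =
     T0 - (T0 - Tm) / erf (mu_1 k \<rho> L T0 Tm q0)
       * erf (x / (2 * lambda_1 k \<rho> L T0 Tm q0 * sqrt t))"

end

theory Submission
  imports Defs
begin

text \<open>Put \<nu> = \<alpha>/2, f(x) = 1 - W(-x; -\<nu>, 1) and m = M_\<nu>. Then f' = m and m'(x) = - W(-x; -\<nu>, 1 - 2\<nu>).
  For 0 \<le> \<nu> \<le> 1/2 and 0 \<le> b \<le> 1 one has W(-x; -\<nu>, b) \<ge> 0 for x \<ge> 0: Gauss's product for 1/Gamma writes it as a
  limit of Taylor coefficients of (1 - z)^(-b) exp (- y (1 - z)^\<nu>), which are nonnegative. Hence f is
  increasing and concave with f \<le> 1, so f(x) m(x) / x decreases strictly from m(0)^2 to 0 while it is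
  positive, and it takes every value in between exactly once; the condition on the data says that
  the value in question is below m(0)^2. A bound on 1/Gamma that is uniform in \<nu> makes the Wright series
  jointly continuous in \<nu> and x up to \<nu> = 1/2, where W(x; -1/2, 0) = -(x/2) W(x; -1/2, 1/2) becomes the
  equation m' = -(x/2) m and gives m(x) = exp(-x^2/4) / sqrt pi and f(x) = erf(x/2). By monotonicity,
  pointwise convergence of f(x) m(x) / x forces the roots \<xi>_\<alpha> to converge to 2 \<mu>_1.\<close>

subsection \<open>Nonnegativity and a uniform bound for the Gauss products\<close>

text \<open>Up to the factor n!, this is the coefficient of z^n in (1 - z)^(-b) exp (- y (1 - z)^\<nu>).
  The induction step is A(n+1, b) = b A(n, b + 1) + \<nu> y A(n, b + 1 - \<nu>).\<close>
lemma pochhammer_wright_sums_nonneg: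
  fixes \<nu> y b :: real
  assumes "0 \<le> \<nu>" "\<nu> \<le> 1" "0 \<le> y" "0 \<le> b"
  shows "\<exists>s\<ge>0. (\<lambda>k. (- y) ^ k / fact k * pochhammer (b - \<nu> * real k) n) sums s"
  using \<open>0 \<le> b\<close>
proof (induction n arbitrary: b)
  case 0
  have "(\<lambda>k. (- y) ^ k / fact k) sums exp (- y)"
    using exp_converges[of "- y"] by (simp add: field_simps)
  then show ?case by (intro exI[of _ "exp (- y)"]) simp
next
  case (Suc n)
  let ?f = "\<lambda>b k. (- y) ^ k / fact k * pochhammer (b - \<nu> * real k) n"
  obtain s1 where s1: "0 \<le> s1" "?f (b + 1) sums s1" using Suc.IH[of "b + 1"] Suc.prems by auto
  obtain s2 where s2: "0 \<le> s2" "?f (b + 1 - \<nu>) sums s2"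
    using Suc.IH[of "b + 1 - \<nu>"] Suc.prems assms by auto
  let ?g = "\<lambda>k. - \<nu> * real k * ?f (b + 1) k"
  have "(\<lambda>k. ?g (Suc k)) sums (\<nu> * y * s2)"
  proof -
    have "?g (Suc k) = \<nu> * y * ?f (b + 1 - \<nu>) k" for k
    proof -
      have "b + 1 - \<nu> * real (Suc k) = b + 1 - \<nu> - \<nu> * real k" by (simp add: algebra_simps)
      then show ?thesis by (simp add: field_simps del: of_nat_Suc)
    qed
    then show ?thesis using sums_mult[OF s2(2), of "\<nu> * y"] by (simp only:)
  qed
  from sums_Suc[OF this] have "?g sums (\<nu> * y * s2)" by simp
  from sums_add[OF sums_mult[OF s1(2), of b] this]
  have "(\<lambda>k. b * ?f (b + 1) k + ?g k) sums (b * s1 + \<nu> * y * s2)" .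
  moreover have "b * ?f (b + 1) k + ?g k = (- y) ^ k / fact k * pochhammer (b - \<nu> * real k) (Suc n)" for k
    by (simp add: pochhammer_rec algebra_simps diff_divide_distrib)
  ultimately have "(\<lambda>k. (- y) ^ k / fact k * pochhammer (b - \<nu> * real k) (Suc n)) sums (b * s1 + \<nu> * y * s2)"
    by simp
  moreover have "0 \<le> b * s1 + \<nu> * y * s2" using s1 s2 Suc.prems assms by simp
  ultimately show ?case by blast
qed

text \<open>With n = j + 1, each induction step brings the factor (n + 1)(1 + \<zeta>/(n + 1)), and
  1/(n + 1) \<le> ln ((n + 1)/n) bounds its second part by ((n + 1)/n)^\<zeta>, so the powers
  telescope. The constant 2 covers \<zeta>(\<zeta> + 1) at n = 1.\<close>

lemma pochhammer_le_fact_powr: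
  fixes \<zeta> :: real
  assumes "0 \<le> \<zeta>" "\<zeta> \<le> 1"
  shows "pochhammer \<zeta> (Suc (Suc j)) \<le> 2 * fact (Suc j) * real (Suc j) powr \<zeta>"
proof (induction j)
  case 0
  have "\<zeta> * (\<zeta> + 1) \<le> 1 * 2" using assms by (intro mult_mono) auto
  then show ?case by (simp add: pochhammer_Suc)
next
  case (Suc j)
  let ?j = "real (Suc j)"
  have "1 + \<zeta> / (?j + 1) \<le> exp (\<zeta> / (?j + 1))" by (rule exp_ge_add_one_self)
  also have "\<dots> \<le> exp (\<zeta> * ln ((?j + 1) / ?j))"
  proof -
    have "ln (?j / (?j + 1)) \<le> ?j / (?j + 1) - 1" by (intro ln_le_minus_one) simp
    also have "\<dots> = - (1 / (?j + 1))" by (simp add: field_simps)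
    finally have "1 / (?j + 1) \<le> ln ((?j + 1) / ?j)" by (simp add: ln_div)
    from mult_left_mono[OF this assms(1)] show ?thesis by simp
  qed
  also have "\<dots> = ((?j + 1) / ?j) powr \<zeta>" by (simp add: powr_def)
  also have "\<dots> = (?j + 1) powr \<zeta> / ?j powr \<zeta>" by (simp add: powr_divide)
  finally have *: "(1 + \<zeta> / (?j + 1)) * ?j powr \<zeta> \<le> (?j + 1) powr \<zeta>"
    by (simp add: field_simps)
  have "pochhammer \<zeta> (Suc (Suc (Suc j))) = pochhammer \<zeta> (Suc (Suc j)) * (\<zeta> + ?j + 1)"
    by (subst pochhammer_Suc) (simp add: algebra_simps)
  also have "\<dots> \<le> (2 * fact (Suc j) * ?j powr \<zeta>) * (\<zeta> + ?j + 1)"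
    by (intro mult_right_mono Suc.IH) (use assms in auto)
  also have "\<dots> = 2 * fact (Suc j) * (?j + 1) * ((1 + \<zeta> / (?j + 1)) * ?j powr \<zeta>)"
    by (simp add: field_simps)
  also have "\<dots> \<le> 2 * fact (Suc j) * (?j + 1) * (?j + 1) powr \<zeta>"
    by (intro mult_left_mono *) simp
  also have "\<dots> = 2 * fact (Suc (Suc j)) * real (Suc (Suc j)) powr \<zeta>"
    by (simp add: algebra_simps)
  finally show ?case .
qed

text \<open>As z lies in [-m, 1 - m], the factor z + i has absolute value at most m - i for i < m,
  and the quotient of factorials is the product of these bounds.\<close>

lemma abs_pochhammer_neg_le:
  fixes z :: real
  assumes "0 \<le> z + real m" "z + real m \<le> 1" "i \<le> m"
  shows "\<bar>pochhammer z i\<bar> \<le> fact m / fact (m - i)"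
  using \<open>i \<le> m\<close>
proof (induction i)
  case (Suc i)
  have "\<bar>pochhammer z (Suc i)\<bar> = \<bar>pochhammer z i\<bar> * \<bar>z + real i\<bar>"
    by (simp add: pochhammer_Suc abs_mult)
  also have "\<dots> \<le> fact m / fact (m - i) * real (m - i)"
    using Suc assms by (intro mult_mono) (auto simp: of_nat_diff)
  also have "fact (m - i) = (fact (m - Suc i) * real (m - i) :: real)"
    using Suc.prems by (simp add: fact_reduce[of "m - i"])
  finally show ?case using Suc.prems by simp
qed simp

lemma le_two_power: "real m \<le> 2 ^ m"
  using of_nat_less_two_power[of m, where 'a = real] by linarith

text \<open>Splitting the rising factorial at the sign change of its factors leaves n^m / (n choose m),
  which is bounded uniformly in n.\<close>
lemma abs_rGamma_series_le:
  fixes z :: real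
  assumes "0 \<le> z + real m" "z + real m \<le> 1" "0 < n"
  shows "\<bar>rGamma_series z n\<bar> \<le> 2 * 4 ^ m * real m ^ m"
proof -
  define \<zeta> where "\<zeta> = z + real m"
  have z: "z = \<zeta> - real m" by (simp add: \<zeta>_def)
  have n: "1 \<le> real n" using assms by simp
  have eq: "\<bar>rGamma_series z n\<bar> = \<bar>pochhammer z (Suc n)\<bar> / fact n * (real n ^ m / real n powr \<zeta>)"
    using assms(3) by (simp add: rGamma_series_def abs_mult powr_def z powr_realpow[symmetric]
        left_diff_distrib exp_diff exp_minus)
  have mm: "0 \<le> real m ^ m" by simp
  have "1 \<le> (4::real) ^ m" by simp
  show ?thesis
  proof (cases "m \<le> n")
    case True
    have "\<bar>pochhammer z m\<bar> \<le> fact m"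
      using abs_pochhammer_neg_le[OF assms(1,2) order.refl] by simp
    moreover have "\<bar>pochhammer \<zeta> (Suc (n - m))\<bar> \<le> 2 * fact (n - m) * real n powr \<zeta>"
    proof (cases "n - m")
      \<comment> \<open>For n = m a single factor remains, too few for
        \<open>pochhammer_le_fact_powr\<close>; it is \<zeta> itself, and \<zeta> \<le> 1 \<le>
        n^\<zeta>.\<close>
      case 0
      have "1 \<le> real n powr \<zeta>" using n assms by (simp add: ge_one_powr_ge_zero \<zeta>_def)
      then show ?thesis using assms 0 by (simp add: \<zeta>_def)
    next
      case (Suc j)
      have "pochhammer \<zeta> (Suc (Suc j)) \<le> 2 * fact (Suc j) * real (Suc j) powr \<zeta>"
        using assms by (intro pochhammer_le_fact_powr) (auto simp: \<zeta>_def)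
      also have "\<dots> \<le> 2 * fact (Suc j) * real n powr \<zeta>"
        using Suc assms by (intro mult_left_mono powr_mono2) (auto simp: \<zeta>_def)
      finally have "pochhammer \<zeta> (Suc (Suc j)) \<le> 2 * fact (Suc j) * real n powr \<zeta>" .
      moreover have "0 \<le> pochhammer \<zeta> (Suc (Suc j))"
        using assms unfolding pochhammer_prod by (intro prod_nonneg) (simp add: \<zeta>_def)
      ultimately show ?thesis unfolding Suc by simp
    qed
    moreover have "pochhammer z (Suc n) = pochhammer z m * pochhammer \<zeta> (Suc (n - m))"
      using pochhammer_product[of m "Suc n" z] True by (simp add: \<zeta>_def Suc_diff_le)
    ultimately have "\<bar>pochhammer z (Suc n)\<bar> \<le> fact m * (2 * fact (n - m) * real n powr \<zeta>)"
      by (simp only: abs_mult) (intro mult_mono, auto)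
    then have "\<bar>rGamma_series z n\<bar>
        \<le> fact m * (2 * fact (n - m) * real n powr \<zeta>) / fact n * (real n ^ m / real n powr \<zeta>)"
      unfolding eq by (intro mult_right_mono divide_right_mono) auto
    also have "\<dots> = 2 * (real n ^ m / real (n choose m))"
      using n True by (simp add: binomial_fact field_simps)
    also have "real n ^ m / real (n choose m) \<le> real m ^ m"
    proof -
      have "real n ^ m \<le> real m ^ m * real (n choose m)"
      proof (cases "m = 0")
        case False
        then show ?thesis
          using binomial_ge_n_over_k_pow_k[OF True, where 'a = real]
          by (simp add: power_divide field_simps)
      qed simp
      then show ?thesis using True by (simp add: field_simps zero_less_binomial)
    qed
    also have "2 * real m ^ m \<le> 2 * 4 ^ m * real m ^ m"
      using mult_right_mono[OF \<open>1 \<le> 4 ^ m\<close> mm] by simp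
    finally show ?thesis by simp
  next
    case False
    then have mn: "Suc n \<le> m" by simp
    have "\<bar>pochhammer z (Suc n)\<bar> / fact n \<le> fact m / fact (m - Suc n) / fact n"
      by (intro divide_right_mono abs_pochhammer_neg_le[OF assms(1,2) mn]) simp
    \<comment> \<open>All n + 1 factors come before the sign change. The quotient is n + 1 times a
      binomial coefficient, both at most 2^m; this is the source of 4^m.\<close>
    also have "\<dots> = real (Suc n) * real (m choose Suc n)"
      using mn by (simp add: binomial_fact del: of_nat_Suc)
    also have "\<dots> \<le> 2 ^ m * 2 ^ m"
    proof (intro mult_mono)
      show "real (Suc n) \<le> 2 ^ m" using mn le_two_power[of m] by linarith
      have "m choose Suc n \<le> 2 ^ m" by (rule binomial_le_pow2)
      then show "real (m choose Suc n) \<le> 2 ^ m"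
        using of_nat_le_iff[of "m choose Suc n" "2 ^ m", where 'a = real] by simp
    qed auto
    also have "\<dots> = (4::real) ^ m" by (simp flip: power_mult_distrib)
    finally have a: "\<bar>pochhammer z (Suc n)\<bar> / fact n \<le> 4 ^ m" .
    have "1 \<le> real n powr \<zeta>" using n assms by (simp add: ge_one_powr_ge_zero \<zeta>_def)
    then have "real n ^ m / real n powr \<zeta> \<le> real n ^ m / 1"
      using n by (intro divide_left_mono) auto
    also have "\<dots> \<le> real m ^ m" using False by (simp add: power_mono)
    finally have b: "real n ^ m / real n powr \<zeta> \<le> real m ^ m" .
    have "\<bar>rGamma_series z n\<bar> \<le> 4 ^ m * real m ^ m"
      unfolding eq using a b by (intro mult_mono) auto
    moreover have "0 \<le> 4 ^ m * real m ^ m" by simp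
    ultimately show ?thesis by linarith
  qed
qed

text \<open>The bound of \<open>abs_rGamma_series_le\<close> at m = k div 2 + 1, which is at least
  every shift that b - \<nu>k can require for \<nu> \<le> 1/2 and 0 \<le> b. It is thus independent
  of \<nu>, b and n.\<close>

definition wright_bound :: "nat \<Rightarrow> real" where
  "wright_bound k = (let j = k div 2 in 2 * 4 ^ Suc j * real (Suc j) ^ Suc j)"

lemma abs_rGamma_series_le_wright_bound:
  assumes "0 \<le> \<nu>" "\<nu> \<le> 1 / 2" "0 \<le> b" "b \<le> 1" "0 < n"
  shows "\<bar>rGamma_series (b - \<nu> * real k) n\<bar> \<le> wright_bound k"
proof -
  \<comment> \<open>The least m that makes b - \<nu>k + m nonnegative; the sum then stays at most
    1.\<close>
  define m where "m = nat \<lceil>\<nu> * real k - b\<rceil>"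
  define j where "j = Suc (k div 2)"
  have "\<nu> * real k \<le> 1 / 2 * real k" using assms by (intro mult_right_mono) auto
  also have "\<dots> \<le> real j" unfolding j_def by linarith
  finally have "m \<le> j" unfolding m_def using assms by linarith
  have "\<nu> * real k \<ge> 0" using assms by simp
  have "0 \<le> b - \<nu> * real k + real m" "b - \<nu> * real k + real m \<le> 1"
    unfolding m_def using assms \<open>\<nu> * real k \<ge> 0\<close> by linarith+
  from abs_rGamma_series_le[OF this assms(5)]
  have "\<bar>rGamma_series (b - \<nu> * real k) n\<bar> \<le> 2 * 4 ^ m * real m ^ m" .
  also have "\<dots> \<le> 2 * 4 ^ j * real j ^ j"
  proof (intro mult_mono)
    show "(4::real) ^ m \<le> 4 ^ j" using \<open>m \<le> j\<close> by (intro power_increasing) auto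
    have "real m ^ m \<le> real j ^ m" using \<open>m \<le> j\<close> by (intro power_mono) auto
    also have "\<dots> \<le> real j ^ j" using \<open>m \<le> j\<close> by (intro power_increasing) (auto simp: j_def)
    finally show "real m ^ m \<le> real j ^ j" .
  qed auto
  also have "\<dots> = wright_bound k" by (simp add: wright_bound_def j_def Let_def)
  finally show ?thesis .
qed

lemma abs_rGamma_le_wright_bound:
  assumes "0 \<le> \<nu>" "\<nu> \<le> 1 / 2" "0 \<le> b" "b \<le> 1"
  shows "\<bar>rGamma (b - \<nu> * real k)\<bar> \<le> wright_bound k"
proof (rule tendsto_upperbound)
  show "(\<lambda>n. \<bar>rGamma_series (b - \<nu> * real k) n\<bar>) \<longlonglongrightarrow> \<bar>rGamma (b - \<nu> * real k)\<bar>"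
    by (intro tendsto_intros)
  show "\<forall>\<^sub>F n in sequentially. \<bar>rGamma_series (b - \<nu> * real k) n\<bar> \<le> wright_bound k"
    using eventually_gt_at_top[of 0]
    by eventually_elim (use assms abs_rGamma_series_le_wright_bound in auto)
qed simp

section \<open>Summability of the uniform bound\<close>

lemma summable_div2:
  fixes g :: "nat \<Rightarrow> real"
  assumes "summable g" "\<And>n. 0 \<le> g n"
  shows "summable (\<lambda>k. g (k div 2))"
proof (rule summableI_nonneg_bounded)
  fix n
  have "(\<Sum>i<n. g (i div 2)) \<le> (\<Sum>i<2 * n. g (i div 2))"
    by (intro sum_mono2) (auto simp: assms)
  also have "\<dots> = 2 * (\<Sum>i<n. g i)" by (induction n) auto
  also have "\<dots> \<le> 2 * suminf g" using sum_le_suminf[OF assms(1)] assms by simp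
  finally show "(\<Sum>i<n. g (i div 2)) \<le> 2 * suminf g" .
qed (simp add: assms)

text \<open>The j factors j + 1, ..., 2j of (2j)!/j! are all at least j + 1.\<close>

lemma fact_mult_power_le: "fact j * real (Suc j) ^ j \<le> fact (2 * j)"
proof -
  have "real (Suc j) ^ i * fact j \<le> fact (j + i)" for i
  proof (induction i)
    case (Suc i)
    have "real (Suc j) * (real (Suc j) ^ i * fact j) \<le> real (Suc (j + i)) * fact (j + i)"
      using Suc by (intro mult_mono) auto
    then show ?case by (simp add: algebra_simps)
  qed simp
  from this[of j] have "real (Suc j) ^ j * fact j \<le> fact (2 * j)" unfolding mult_2 .
  then show ?thesis by (subst mult.commute)
qed

text \<open>With j = k div 2, k! \<ge> j! (j + 1)^j reduces the (j + 1)^(j + 1) in the bound to j +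
  1 \<le> 2^j. What is left is a multiple of (8 X^2)^j / j!, an exponential series in which each
  term occurs twice.\<close>

lemma summable_wright_bound:
  assumes "0 \<le> x"
  shows "summable (\<lambda>k. x ^ k / fact k * wright_bound k)"
proof -
  define X where "X = max 1 x"
  have X: "1 \<le> X" "x \<le> X" by (auto simp: X_def)
  define g where "g j = 8 * X * ((8 * X\<^sup>2) ^ j / fact j)" for j :: nat
  have g0: "0 \<le> g j" for j using X by (simp add: g_def)
  have "summable g" unfolding g_def
    using summable_exp[of "8 * X\<^sup>2"] by (intro summable_mult) (simp add: field_simps)
  then have "summable (\<lambda>k. g (k div 2))" by (rule summable_div2) (rule g0)
  then show ?thesis
  proof (rule summable_comparison_test')
    fix k :: nat
    define j where "j = k div 2"
    have "x ^ k \<le> X ^ k" using assms X by (intro power_mono) auto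
    also have "\<dots> \<le> X ^ Suc (2 * j)" using X by (intro power_increasing) (auto simp: j_def)
    finally have xk: "x ^ k \<le> X ^ Suc (2 * j)" .
    have "fact j * real (Suc j) ^ j \<le> fact (2 * j)" by (rule fact_mult_power_le)
    also have "\<dots> \<le> fact k" by (intro fact_mono) (simp add: j_def)
    finally have fk: "fact j * real (Suc j) ^ j \<le> fact k" .
    have "x ^ k / fact k \<le> X ^ Suc (2 * j) / (fact j * real (Suc j) ^ j)"
      using xk fk X assms by (intro frac_le) auto
    then have "x ^ k / fact k * wright_bound k
        \<le> X ^ Suc (2 * j) / (fact j * real (Suc j) ^ j) * (2 * 4 ^ Suc j * real (Suc j) ^ Suc j)"
      unfolding wright_bound_def Let_def j_def[symmetric] by (intro mult_right_mono) auto
    also have "\<dots> = 8 * X * (X ^ (2 * j) * 4 ^ j / fact j) * real (Suc j)"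
      by (simp add: field_simps del: of_nat_Suc)
    also have "\<dots> \<le> 8 * X * (X ^ (2 * j) * 4 ^ j / fact j) * 2 ^ j"
    proof (intro mult_left_mono)
      have "Suc j \<le> 2 ^ j" by (simp add: Suc_leI)
      then show "real (Suc j) \<le> 2 ^ j"
        using of_nat_le_iff[of "Suc j" "2 ^ j", where 'a = real] by simp
    qed (use X in auto)
    also have "(4::real) ^ j = 2 ^ j * 2 ^ j" by (simp flip: power_mult_distrib)
    also have "(8::real) * X * (X ^ (2 * j) * (2 ^ j * 2 ^ j) / fact j) * 2 ^ j = g j"
    proof -
      have "(8 * X\<^sup>2) ^ j = X ^ (2 * j) * (2 ^ j * 2 ^ j * 2 ^ j)"
        unfolding power_mult power_mult_distrib[symmetric] by (simp add: mult.commute)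
      then show ?thesis unfolding g_def by simp
    qed
    finally have "x ^ k / fact k * wright_bound k \<le> g (k div 2)" by (simp add: j_def)
    moreover have "0 \<le> x ^ k / fact k * wright_bound k"
      using assms by (simp add: wright_bound_def Let_def)
    ultimately show "norm (x ^ k / fact k * wright_bound k) \<le> g (k div 2)" by simp
  qed
qed

subsection \<open>The Wright function with parameter in [-1/2, 0]\<close>

text \<open>Dominated convergence for series. The general filter serves two purposes: the passage
  from Gauss products to 1/Gamma, and continuity in the parameters.\<close>

lemma wright_tannery:
  fixes a :: "nat \<Rightarrow> 'c \<Rightarrow> real" and x :: "'c \<Rightarrow> real"
  assumes "F \<noteq> bot"
    and x: "(x \<longlongrightarrow> y) F"
    and a: "\<And>k. (a k \<longlongrightarrow> b k) F"
    and bound: "\<forall>\<^sub>F s in F. \<forall>k. \<bar>a k s\<bar> \<le> wright_bound k"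
  shows "((\<lambda>s. \<Sum>k. x s ^ k / fact k * a k s) \<longlongrightarrow> (\<Sum>k. y ^ k / fact k * b k)) F"
proof -
  define Y where "Y = \<bar>y\<bar> + 1"
  have ev: "\<forall>\<^sub>F s in F. \<bar>x s\<bar> < Y"
    using order_tendstoD(2)[OF tendsto_rabs[OF x], of Y] by (simp add: Y_def)
  have "\<forall>\<^sub>F s in F. \<forall>k. norm (x s ^ k / fact k * a k s) \<le> Y ^ k / fact k * wright_bound k"
    using ev bound
  proof eventually_elim
    case (elim s)
    then show ?case
      by (auto simp: abs_mult power_abs intro!: mult_mono divide_right_mono power_mono)
  qed
  then have *: "\<forall>\<^sub>F (k, s) in at_top \<times>\<^sub>F F. norm (x s ^ k / fact k * a k s) \<le> Y ^ k / fact k * wright_bound k"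
    unfolding eventually_prod_filter
    by (intro exI[of _ "\<lambda>_. True"] exI[of _ "\<lambda>s. \<forall>k. norm (x s ^ k / fact k * a k s) \<le> Y ^ k / fact k * wright_bound k"]) auto
  have "((\<lambda>s. x s ^ k / fact k * a k s) \<longlongrightarrow> y ^ k / fact k * b k) F" for k
    by (intro tendsto_intros x a) simp
  from tannerys_theorem[OF this * summable_wright_bound assms(1)] show ?thesis
    by (simp add: Y_def)
qed

context
  fixes \<nu> b :: real
  assumes \<nu>: "0 \<le> \<nu>" "\<nu> \<le> 1 / 2" and b: "0 \<le> b" "b \<le> 1"
begin

lemma Wright_neg_eq: "Wright x (- \<nu>) b = (\<Sum>k. x ^ k / fact k * rGamma (b - \<nu> * real k))"
  by (simp add: Wright_def algebra_simps)

lemma summable_Wright: "summable (\<lambda>k. x ^ k / fact k * rGamma (b - \<nu> * real k))"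
  by (rule summable_comparison_test'[OF summable_wright_bound[of "\<bar>x\<bar>"]])
     (auto simp: abs_mult power_abs intro!: mult_left_mono divide_right_mono abs_rGamma_le_wright_bound \<nu> b)

text \<open>The partial Gauss products of 1/Gamma turn the Wright series into the sums of
  \<open>pochhammer_wright_sums_nonneg\<close>, at the argument \<open>x n powr \<nu>\<close>.\<close>
lemma Wright_nonneg:
  assumes "0 \<le> x"
  shows "0 \<le> Wright (- x) (- \<nu>) b"
proof (rule tendsto_lowerbound)
  let ?S = "\<lambda>n. \<Sum>k. (- x) ^ k / fact k * rGamma_series (b - \<nu> * real k) n"
  show "?S \<longlonglongrightarrow> Wright (- x) (- \<nu>) b"
    unfolding Wright_neg_eq
  proof (rule wright_tannery)
    show "\<forall>\<^sub>F n in sequentially. \<forall>k. \<bar>rGamma_series (b - \<nu> * real k) n\<bar> \<le> wright_bound k"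
      using eventually_gt_at_top[of 0]
      by eventually_elim (use \<nu> b abs_rGamma_series_le_wright_bound in auto)
  qed (auto intro: tendsto_intros)
  have "0 \<le> ?S n" for n
  proof -
    \<comment> \<open>In n^(-(b - \<nu>k)) the part n^(\<nu>k) is the k-th power of n^\<nu> and
      joins x; the part n^(-b), with 1/n!, is common to all terms.\<close>
    define y where "y = x * exp (\<nu> * ln (real n))"
    define C where "C = exp (- b * ln (real n)) / fact n"
    obtain s where s: "0 \<le> s"
      "(\<lambda>k. (- y) ^ k / fact k * pochhammer (b - \<nu> * real k) (Suc n)) sums s"
      using pochhammer_wright_sums_nonneg[of \<nu> y b "Suc n"] \<nu> b assms by (auto simp: y_def)
    have "(- x) ^ k / fact k * rGamma_series (b - \<nu> * real k) n
        = C * ((- y) ^ k / fact k * pochhammer (b - \<nu> * real k) (Suc n))" for k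
    proof -
      have "exp (\<nu> * ln (real n)) ^ k = exp (\<nu> * real k * ln (real n))"
        by (simp add: mult_ac flip: exp_of_nat_mult)
      moreover have "exp ((b - \<nu> * real k) * ln (real n))
          = exp (b * ln (real n)) / exp (\<nu> * real k * ln (real n))"
        by (simp add: left_diff_distrib exp_diff)
      ultimately show ?thesis
        by (simp add: rGamma_series_def C_def y_def exp_minus power_mult_distrib field_simps
            power_minus[of "x * _"] power_minus[of x])
    qed
    then have "(\<lambda>k. (- x) ^ k / fact k * rGamma_series (b - \<nu> * real k) n) sums (C * s)"
      using sums_mult[OF s(2), of C] by simp
    then have "?S n = C * s" by (rule sums_unique[symmetric])
    then show ?thesis using s by (simp add: C_def)
  qed
  then show "\<forall>\<^sub>F n in sequentially. 0 \<le> ?S n" by simp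
qed simp

lemma Wright_0: "Wright 0 (- \<nu>) b = rGamma b"
  unfolding Wright_neg_eq
  using powser_zero[of "\<lambda>k. rGamma (b - \<nu> * real k) / fact k"] by (simp add: mult.commute)

text \<open>Termwise differentiation shifts k by one, which lowers the last parameter by \<nu>; the
  new parameter b - \<nu> may be negative.\<close>

lemma has_field_derivative_Wright:
  "((\<lambda>x. Wright x (- \<nu>) b) has_field_derivative Wright x (- \<nu>) (b - \<nu>)) (at x)"
proof -
  define c where "c k = rGamma (b - \<nu> * real k) / fact k" for k
  have eq: "Wright x (- \<nu>) b = (\<Sum>k. c k * x ^ k)" for x
    unfolding Wright_neg_eq c_def by (simp add: field_simps)
  have "diffs c k * x ^ k = x ^ k / fact k * rGamma (real k * - \<nu> + (b - \<nu>))" for k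
  proof -
    have "b - \<nu> * real (Suc k) = real k * - \<nu> + (b - \<nu>)" by (simp add: algebra_simps)
    then show ?thesis unfolding diffs_def c_def
      by (simp add: field_simps del: of_nat_Suc)
  qed
  then have "(\<Sum>k. diffs c k * x ^ k) = Wright x (- \<nu>) (b - \<nu>)" by (simp add: Wright_def)
  moreover have "summable (\<lambda>n. c n * y ^ n)" for y
    using summable_Wright[of y] by (simp add: c_def field_simps)
  ultimately show ?thesis
    using termdiffs_strong_converges_everywhere[of c x] unfolding eq by simp
qed

end

text \<open>1/Gamma is continuous everywhere, its values at the poles of Gamma being 0, and
  \<open>wright_bound\<close> does not depend on the parameters, so all three arguments may vary at
  once.\<close>

lemma tendsto_Wright:
  fixes \<nu> b x :: "'c \<Rightarrow> real"
  assumes "F \<noteq> bot" "(\<nu> \<longlongrightarrow> \<nu>0) F" "(b \<longlongrightarrow> b0) F" "(x \<longlongrightarrow> x0) F"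
    and ev: "\<forall>\<^sub>F s in F. 0 \<le> \<nu> s \<and> \<nu> s \<le> 1 / 2 \<and> 0 \<le> b s \<and> b s \<le> 1"
  shows "((\<lambda>s. Wright (x s) (- \<nu> s) (b s)) \<longlongrightarrow> Wright x0 (- \<nu>0) b0) F"
  unfolding Wright_def
proof (rule wright_tannery[OF assms(1,4)])
  show "((\<lambda>s. rGamma (real k * - \<nu> s + b s)) \<longlongrightarrow> rGamma (real k * - \<nu>0 + b0)) F" for k
    by (intro isCont_tendsto_compose[OF isCont_rGamma] tendsto_intros assms continuous_ident)
  show "\<forall>\<^sub>F s in F. \<forall>k. \<bar>rGamma (real k * - \<nu> s + b s)\<bar> \<le> wright_bound k"
    using ev
  proof eventually_elim
    case (elim s)
    then show ?case
      using abs_rGamma_le_wright_bound[of "\<nu> s" "b s"] by (simp add: algebra_simps)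
  qed
qed

section \<open>Derivatives of f and m, and the case \<nu> = 1/2\<close>

lemma DERIV_one_minus_Wright:
  assumes "0 \<le> \<nu>" "\<nu> \<le> 1 / 2"
  shows "((\<lambda>x. 1 - Wright (- x) (- \<nu>) 1) has_real_derivative Mainardi \<nu> x) (at x)"
  using DERIV_chain2[OF has_field_derivative_Wright[of \<nu> 1 "- x"] DERIV_minus[OF DERIV_ident]] assms
  by (auto simp: Mainardi_def intro!: derivative_eq_intros)

lemma DERIV_Mainardi:
  assumes "0 \<le> \<nu>" "\<nu> \<le> 1 / 2"
  shows "(Mainardi \<nu> has_real_derivative - Wright (- x) (- \<nu>) (1 - 2 * \<nu>)) (at x)"
  using DERIV_chain2[OF has_field_derivative_Wright[of \<nu> "1 - \<nu>" "- x"] DERIV_minus[OF DERIV_ident]] assms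
  by (auto simp: Mainardi_def[abs_def] intro!: derivative_eq_intros)

text \<open>The term k = 0 vanishes because 1/Gamma is 0 at 0. In the others, 1/Gamma(z) = z/Gamma(z
  + 1) with z = -\<nu>(k + 1) cancels one factor of (k + 1)!.\<close>

lemma Wright_zero_parameter:
  assumes "0 \<le> \<nu>" "\<nu> \<le> 1 / 2"
  shows "Wright x (- \<nu>) 0 = - \<nu> * x * Wright x (- \<nu>) (1 - \<nu>)"
proof -
  let ?f = "\<lambda>k. x ^ k / fact k * rGamma (0 - \<nu> * real k)"
  have "?f (Suc k) = - \<nu> * x * (x ^ k / fact k * rGamma (1 - \<nu> - \<nu> * real k))" for k
  proof -
    define z where "z = - \<nu> * real (Suc k)"
    have "1 - \<nu> - \<nu> * real k = z + 1" "0 - \<nu> * real (Suc k) = z" by (simp_all add: z_def algebra_simps)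
    then have "rGamma (0 - \<nu> * real (Suc k)) = - \<nu> * real (Suc k) * rGamma (1 - \<nu> - \<nu> * real k)"
      using rGamma_plus1[of z] by (simp only: z_def)
    then show ?thesis by (simp add: field_simps del: of_nat_Suc)
  qed
  moreover have "(\<lambda>k. x ^ k / fact k * rGamma (1 - \<nu> - \<nu> * real k)) sums Wright x (- \<nu>) (1 - \<nu>)"
    using summable_sums[OF summable_Wright[of \<nu> "1 - \<nu>" x]] Wright_neg_eq[of \<nu> "1 - \<nu>" x] assms by simp
  from sums_mult[OF this, of "- \<nu> * x"]
  have "(\<lambda>k. - \<nu> * x * (x ^ k / fact k * rGamma (1 - \<nu> - \<nu> * real k))) sums (- \<nu> * x * Wright x (- \<nu>) (1 - \<nu>))" .
  ultimately have "(\<lambda>k. ?f (Suc k)) sums (- \<nu> * x * Wright x (- \<nu>) (1 - \<nu>))" by (simp only:)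
  from sums_Suc[OF this] have "?f sums (- \<nu> * x * Wright x (- \<nu>) (1 - \<nu>))" by simp
  then show ?thesis using Wright_neg_eq[of \<nu> 0 x] assms by (simp add: sums_iff)
qed

lemma Mainardi_half: "Mainardi (1 / 2) x = exp (- (x\<^sup>2 / 4)) / sqrt pi"
proof -
  \<comment> \<open>exp (x^2/4) is the integrating factor of m' = -(x/2) m.\<close>
  define h where "h x = Mainardi (1 / 2) x * exp (x\<^sup>2 / 4)" for x
  have "(h has_real_derivative 0) (at x)" for x
  proof -
    have "Wright (- x) (- (1 / 2)) 0 = x / 2 * Mainardi (1 / 2) x"
      using Wright_zero_parameter[of "1 / 2" "- x"] by (simp add: Mainardi_def)
    then have "(Mainardi (1 / 2) has_real_derivative - (x / 2 * Mainardi (1 / 2) x)) (at x)"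
      using DERIV_Mainardi[of "1 / 2" x] by (simp del: times_divide_eq_left)
    then show ?thesis unfolding h_def[abs_def]
      by (auto intro!: derivative_eq_intros simp: algebra_simps)
  qed
  then have "h x = h 0" by (intro DERIV_isconst_all) auto
  also have "h 0 = 1 / sqrt pi"
    using Wright_0[of "1 / 2" "1 / 2"] by (simp add: h_def Mainardi_def rGamma_inverse_Gamma Gamma_one_half_real field_simps)
  finally show ?thesis by (simp add: h_def exp_minus field_simps)
qed

text \<open>The argument 2u turns the Gaussian exp (-x^2/4) of \<open>Mainardi_half\<close> into exp
  (-u^2), so the left side is an antiderivative up to the factor 2/sqrt pi.\<close>

lemma one_minus_Wright_half:
  assumes "0 \<le> x"
  shows "1 - Wright (- (2 * x)) (- (1 / 2)) 1 = erf x"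
proof -
  let ?F = "\<lambda>u. sqrt pi / 2 * (1 - Wright (- (2 * u)) (- (1 / 2)) 1)"
  have "((\<lambda>u. exp (- u\<^sup>2)) has_integral (?F x - ?F 0)) {0..x}"
  proof (rule fundamental_theorem_of_calculus[OF assms])
    fix u :: real
    have "((\<lambda>u. 1 - Wright (- (2 * u)) (- (1 / 2)) 1) has_real_derivative Mainardi (1 / 2) (2 * u) * 2) (at u)"
      using DERIV_chain2[OF DERIV_one_minus_Wright[of "1 / 2" "2 * u"] DERIV_cmult_Id[of 2 u]] by simp
    from DERIV_cmult[OF this, of "sqrt pi / 2"]
    have "(?F has_real_derivative exp (- u\<^sup>2)) (at u)"
      by (simp add: Mainardi_half power_mult_distrib)
    then show "(?F has_vector_derivative exp (- u\<^sup>2)) (at u within {0..x})"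
      by (auto simp: has_real_derivative_iff_has_vector_derivative[symmetric] intro: DERIV_subset)
  qed
  then show ?thesis
    using assms Wright_0[of "1 / 2" 1] by (simp add: erf_def integral_unique)
qed

subsection \<open>Concave profiles and their roots\<close>

text \<open>Here m = f' and n = -m', so f is concave and increasing on the nonnegative axis.
  Positivity of n just to the right of 0 suffices for the strict inequalities below. The same facts
  then serve for every \<alpha> and for the limit \<alpha> = 1.\<close>

locale concave_profile =
  fixes f m n :: "real \<Rightarrow> real"
  assumes df: "\<And>x. (f has_real_derivative m x) (at x)"
    and dm: "\<And>x. (m has_real_derivative - n x) (at x)"
    and f0: "f 0 = 0"
    and f_le: "\<And>x. 0 \<le> x \<Longrightarrow> f x \<le> 1"
    and m_nonneg: "\<And>x. 0 \<le> x \<Longrightarrow> 0 \<le> m x"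
    and n_nonneg: "\<And>x. 0 \<le> x \<Longrightarrow> 0 \<le> n x"
    and n_pos: "\<forall>\<^sub>F x in at_right 0. 0 < n x"
begin

lemma m_antimono: "0 \<le> x \<Longrightarrow> x \<le> y \<Longrightarrow> m y \<le> m x"
  by (rule DERIV_nonpos_imp_nonincreasing[of x y m]) (use dm n_nonneg in force)+

text \<open>f(x) - x m(x) vanishes at 0 and has derivative x n(x): it increases strictly on an
  initial interval and does not decrease afterwards.\<close>

lemma mult_m_less_f:
  assumes "0 < x"
  shows "x * m x < f x"
proof -
  define g where "g x = f x - x * m x" for x
  have dg: "(g has_real_derivative x * n x) (at x)" for x
    unfolding g_def[abs_def] by (auto intro!: derivative_eq_intros df dm)
  obtain \<delta> where \<delta>: "0 < \<delta>" "\<And>x. 0 < x \<Longrightarrow> x < \<delta> \<Longrightarrow> 0 < n x"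
    using n_pos unfolding eventually_at_right_field by auto
  define d where "d = min \<delta> x"
  have "g 0 < g d"
  proof (rule DERIV_pos_imp_increasing_open[of 0 d g])
    show "\<exists>y. (g has_real_derivative y) (at u) \<and> 0 < y" if "0 < u" "u < d" for u
      using dg[of u] \<delta>(2)[of u] that by (auto simp: d_def)
    show "continuous_on {0..d} g" using dg DERIV_isCont continuous_at_imp_continuous_on by blast
  qed (use assms \<delta> in \<open>auto simp: d_def\<close>)
  also have "g d \<le> g x"
  proof (rule DERIV_nonneg_imp_nondecreasing[of d x g])
    show "\<exists>y. (g has_real_derivative y) (at u) \<and> 0 \<le> y" if "d \<le> u" "u \<le> x" for u
    proof -
      have "0 \<le> u" using that \<delta>(1) assms by (auto simp: d_def min_def split: if_splits)
      then show ?thesis using dg[of u] n_nonneg[of u] by auto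
    qed
  qed (simp add: d_def)
  finally show ?thesis by (simp add: g_def f0)
qed

lemma f_pos: "0 < x \<Longrightarrow> 0 < f x"
  using mult_m_less_f[of x] m_nonneg[of x] by (smt (verit) mult_nonneg_nonneg)

lemma f_div_strict_antimono:
  assumes "0 < x" "x < y"
  shows "f y / y < f x / x"
proof (rule DERIV_neg_imp_decreasing[OF assms(2)])
  fix u assume "x \<le> u" "u \<le> y"
  then have "0 < u" using assms by simp
  have "((\<lambda>u. f u / u) has_real_derivative (m u * u - f u) / (u * u)) (at u)"
    using \<open>0 < u\<close> by (auto intro!: derivative_eq_intros df)
  moreover have "(m u * u - f u) / (u * u) < 0"
    using mult_m_less_f[OF \<open>0 < u\<close>] \<open>0 < u\<close> by (simp add: divide_neg_pos mult.commute)
  ultimately show "\<exists>l. ((\<lambda>u. f u / u) has_real_derivative l) (at u) \<and> l < 0" by blast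
qed

text \<open>Product form of the root equation f(x)/x = K/m(x); it avoids dividing by m, which is
  only known to be nonnegative.\<close>

definition G :: "real \<Rightarrow> real" where "G x = f x / x * m x"

lemma G_antimono:
  assumes "0 < x" "x \<le> y"
  shows "G y \<le> G x"
proof (cases "x = y")
  case False
  then show ?thesis unfolding G_def
    using assms f_div_strict_antimono[of x y] f_pos[of x] m_antimono[of x y] m_nonneg[of y]
    by (intro mult_mono) auto
qed simp

text \<open>Strictness comes from f(x)/x alone; G x > 0 ensures that the factor m x does not destroy
  it.\<close>

lemma G_strict_antimono:
  assumes "0 < x" "x < y" "0 < G x"
  shows "G y < G x"
proof -
  have "0 < m x" using assms m_nonneg[of x] by (auto simp: G_def less_le)
  have "G y \<le> f y / y * m x" unfolding G_def
    using assms m_antimono[of x y] f_pos[of y] by (intro mult_left_mono) auto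
  also have "\<dots> < G x" unfolding G_def
    using \<open>0 < m x\<close> f_div_strict_antimono[OF assms(1,2)] by (rule mult_strict_right_mono[rotated])
  finally show ?thesis .
qed

text \<open>If m x = 0, then 1 / m x is 0 by convention and both sides fail, because f x > 0 and K >
  0.\<close>

lemma equation_iff:
  assumes "0 < x" "0 < K"
  shows "f x / x = K * (1 / m x) \<longleftrightarrow> G x = K"
  using f_pos[OF assms(1)] assms by (cases "m x = 0") (auto simp: G_def field_simps)

lemma ex1_G:
  assumes "0 < K" "K < (m 0)\<^sup>2"
  shows "\<exists>!x. 0 < x \<and> G x = K"
proof -
  have cont: "isCont f x" "isCont m x" for x
    using df dm by (auto intro: DERIV_isCont)
  \<comment> \<open>As f 0 = 0, f(x)/x is the difference quotient of f at 0 and tends to m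
    0.\<close>
  have "((\<lambda>x. f x / x * m x) \<longlongrightarrow> m 0 * m 0) (at 0)"
    using df[of 0] cont(2)[of 0] by (intro tendsto_mult) (auto simp: DERIV_def f0 isCont_def)
  then have "(G \<longlongrightarrow> m 0 * m 0) (at_right 0)"
    unfolding G_def[abs_def] by (rule tendsto_mono[OF at_le, rotated]) auto
  then have "\<forall>\<^sub>F x in at_right 0. K < G x"
    using assms by (intro order_tendstoD) (auto simp: power2_eq_square)
  then obtain p where p: "0 < p" "K < G p"
    unfolding eventually_at_right_field by (metis dense)
  \<comment> \<open>Since f \<le> 1 and m R \<le> m 0, G R is at most m 0 / R, hence at most K once
    R \<ge> m 0 / K.\<close>
  define R where "R = max p (m 0 / K)"
  have R: "p \<le> R" "m 0 / K \<le> R" "0 < R" using p by (auto simp: R_def)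
  have "G R \<le> 1 / R * m 0" unfolding G_def
    using R f_le[of R] m_antimono[of 0 R] m_nonneg[of R] by (intro mult_mono divide_right_mono) auto
  also have "\<dots> \<le> K" using R assms by (simp add: field_simps)
  finally have "G R \<le> K" .
  moreover have "isCont G u" if "p \<le> u" for u
    using that p unfolding G_def[abs_def] by (intro continuous_intros cont) auto
  ultimately obtain x where x: "p \<le> x" "G x = K"
    using IVT2[of G R K p] p R by auto
  show ?thesis
  proof (rule ex1I)
    show "0 < x \<and> G x = K" using x p by auto
    fix y assume "0 < y \<and> G y = K"
    then show "y = x"
      using G_strict_antimono[of x y] G_strict_antimono[of y x] x p assms by (cases x y rule: linorder_cases) auto
  qed
qed

end

text \<open>For 0 < a < \<xi>0 the limit profile has G a > K0, so eventually the approximating G at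
  a exceeds K s, its value at \<xi> s; as it is decreasing, a < \<xi> s. The case a > \<xi>0 is
  symmetric.\<close>

lemma tendsto_profile_root:
  fixes \<xi> K :: "'c \<Rightarrow> real"
  assumes lim: "concave_profile f m n" and \<xi>0: "0 < \<xi>0" "concave_profile.G f m \<xi>0 = K0" "0 < K0"
    and prof: "\<forall>\<^sub>F s in F. concave_profile (fs s) (ms s) (ns s) \<and> 0 < \<xi> s
      \<and> concave_profile.G (fs s) (ms s) (\<xi> s) = K s"
    and f: "\<And>x. 0 < x \<Longrightarrow> ((\<lambda>s. fs s x) \<longlongrightarrow> f x) F"
    and m: "\<And>x. 0 < x \<Longrightarrow> ((\<lambda>s. ms s x) \<longlongrightarrow> m x) F"
    and K: "(K \<longlongrightarrow> K0) F"
  shows "(\<xi> \<longlongrightarrow> \<xi>0) F"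
proof -
  interpret concave_profile f m n by fact
  have G: "((\<lambda>s. fs s a / a * ms s a - K s) \<longlongrightarrow> G a - K0) F" if "0 < a" for a
    unfolding G_def using that by (intro tendsto_intros f m K) auto
  show ?thesis
  proof (rule order_tendstoI)
    fix a assume "a < \<xi>0"
    show "\<forall>\<^sub>F s in F. a < \<xi> s"
    proof (cases "0 < a")
      case True
      have "0 < G a" using G_antimono[of a \<xi>0] True \<open>a < \<xi>0\<close> \<xi>0 by simp
      then have "0 < G a - K0" using G_strict_antimono[of a \<xi>0] True \<open>a < \<xi>0\<close> \<xi>0 by simp
      from order_tendstoD(1)[OF G[OF True] this] prof show ?thesis
      proof eventually_elim
        case (elim s)
        then interpret s: concave_profile "fs s" "ms s" "ns s" by blast
        show ?case using s.G_antimono[of "\<xi> s" a] elim True by (force simp: s.G_def)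
      qed
    next
      case False
      from prof show ?thesis by eventually_elim (use False in auto)
    qed
  next
    fix a assume "\<xi>0 < a"
    have "G a - K0 < 0" using G_strict_antimono[of \<xi>0 a] \<open>\<xi>0 < a\<close> \<xi>0 by simp
    have "0 < a" using \<open>\<xi>0 < a\<close> \<xi>0 by simp
    from order_tendstoD(2)[OF G[OF this] \<open>G a - K0 < 0\<close>] prof
    show "\<forall>\<^sub>F s in F. \<xi> s < a"
    proof eventually_elim
      case (elim s)
      then interpret s: concave_profile "fs s" "ms s" "ns s" by blast
      show ?case using s.G_antimono[of a "\<xi> s"] elim \<open>0 < a\<close> by (force simp: s.G_def)
    qed
  qed
qed

text \<open>For \<nu> < 1/2, n(0) = 1/Gamma(1 - 2\<nu>) > 0 and continuity gives positivity near 0.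
  At \<nu> = 1/2, n(0) = 0, and the explicit form n(x) = (x/2) m(x) is used instead.\<close>

lemma concave_profile_Wright:
  assumes "0 < \<nu>" "\<nu> \<le> 1 / 2"
  shows "concave_profile (\<lambda>x. 1 - Wright (- x) (- \<nu>) 1) (Mainardi \<nu>) (\<lambda>x. Wright (- x) (- \<nu>) (1 - 2 * \<nu>))"
proof
  show "\<forall>\<^sub>F x in at_right 0. 0 < Wright (- x) (- \<nu>) (1 - 2 * \<nu>)"
  proof (cases "\<nu> = 1 / 2")
    case True
    have "0 < Wright (- x) (- \<nu>) (1 - 2 * \<nu>)" if "0 < x" for x
    proof -
      have "Wright (- x) (- \<nu>) (1 - 2 * \<nu>) = x / 2 * Mainardi (1 / 2) x"
        unfolding True using Wright_zero_parameter[of "1 / 2" "- x"] by (simp add: Mainardi_def)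
      also have "\<dots> > 0" using that by (simp add: Mainardi_half)
      finally show ?thesis .
    qed
    then show ?thesis by (auto simp: eventually_at_filter)
  next
    case False
    have "((\<lambda>x. Wright (- x) (- \<nu>) (1 - 2 * \<nu>)) \<longlongrightarrow> Wright 0 (- \<nu>) (1 - 2 * \<nu>)) (at_right 0)"
      using assms by (intro tendsto_Wright) (auto intro!: tendsto_eq_intros)
    moreover have "0 < Wright 0 (- \<nu>) (1 - 2 * \<nu>)"
      using assms False by (subst Wright_0) (auto simp: rGamma_inverse_Gamma Gamma_real_pos)
    ultimately show ?thesis by (rule order_tendstoD(1))
  qed
qed (use assms Wright_0[of \<nu> 1] Wright_nonneg[of \<nu>] Wright_nonneg[of \<nu> "1 - \<nu>", folded Mainardi_def] in
      \<open>auto intro: DERIV_one_minus_Wright DERIV_Mainardi\<close>)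

subsection \<open>The limit of the fractional solutions\<close>

text \<open>The clauses on unique existence show that the THE-terms behind \<xi>_\<alpha> and
  \<mu>_1 denote roots. The data condition is assumed at \<alpha> = 1 and carries over to \<alpha>
  near 1 by continuity of Gamma.\<close>

theorem theorem3:
  fixes k \<rho> L T0 Tm q0 :: real
  assumes "0 < k" and "0 < \<rho>" and "0 < L" and "0 < q0" and "Tm < T0"
    and "k * \<rho> * L * (T0 - Tm) / (2 * q0\<^sup>2) < 1"
  shows
    "((\<lambda>\<alpha>. k * \<rho> * L * (T0 - Tm) * Gamma (1 + \<alpha> / 2) / (q0\<^sup>2 * Gamma (1 - \<alpha> / 2)))
        \<longlongrightarrow> k * \<rho> * L * (T0 - Tm) / (2 * q0\<^sup>2)) (at_left 1)
     \<and> (\<forall>\<^sub>F \<alpha> in at_left 1.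
          k * \<rho> * L * (T0 - Tm) * Gamma (1 + \<alpha> / 2) / (q0\<^sup>2 * Gamma (1 - \<alpha> / 2)) < 1
          \<and> (\<exists>!x. 0 < x \<and>
               (1 - Wright (- x) (- \<alpha> / 2) 1) / x =
                 k * \<rho> * L * (T0 - Tm) * Gamma (1 + \<alpha> / 2) / (q0\<^sup>2 * Gamma (1 - \<alpha> / 2) ^ 3)
                 * (1 / Mainardi (\<alpha> / 2) x)))
     \<and> (\<exists>!x. 0 < x \<and> exp (x\<^sup>2) = q0\<^sup>2 * sqrt pi / (k * \<rho> * L * (T0 - Tm)) * (erf x / x))
     \<and> lambda_1 k \<rho> L T0 Tm q0 = k * (T0 - Tm) / (q0 * sqrt pi * erf (mu_1 k \<rho> L T0 Tm q0))
     \<and> ((\<lambda>\<alpha>. c_alpha k \<rho> L T0 Tm q0 \<alpha>) \<longlongrightarrow> c_1 k \<rho> L T0 Tm q0) (at_left 1)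
     \<and> (\<forall>t>0. ((\<lambda>\<alpha>. s_alpha k \<rho> L T0 Tm q0 \<alpha> t) \<longlongrightarrow> s_1 k \<rho> L T0 Tm q0 t) (at_left 1))
     \<and> (\<forall>t>0. \<forall>x\<ge>0. ((\<lambda>\<alpha>. T_alpha k \<rho> L T0 Tm q0 \<alpha> x t) \<longlongrightarrow> T_1 k \<rho> L T0 Tm q0 x t)
                       (at_left 1))"
proof -
  define D where "D = k * \<rho> * L * (T0 - Tm)"
  have D: "0 < D" "D / (2 * q0\<^sup>2) < 1" using assms by (simp_all add: D_def)
  define K where "K \<alpha> = D * Gamma (1 + \<alpha> / 2) / (q0\<^sup>2 * Gamma (1 - \<alpha> / 2) ^ 3)" for \<alpha> :: real
  define f where "f \<alpha> x = 1 - Wright (- x) (- \<alpha> / 2) 1" for \<alpha> x :: real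
  define m where "m \<alpha> = Mainardi (\<alpha> / 2)" for \<alpha> :: real
  define n where "n \<alpha> x = Wright (- x) (- \<alpha> / 2) (1 - \<alpha>)" for \<alpha> x :: real
  define \<xi> where "\<xi> = xi_alpha k \<rho> L T0 Tm q0"
  define \<mu> where "\<mu> = mu_1 k \<rho> L T0 Tm q0"
  note at_left_nt = trivial_limit_at_left_real[of "1::real"]
  have Gamma_half: "Gamma (1 / 2 :: real) = sqrt pi" by (rule Gamma_one_half_real)
  have Gamma_3_half: "Gamma (3 / 2 :: real) = sqrt pi / 2"
  proof -
    have "(1 / 2 :: real) \<notin> \<int>\<^sub>\<le>\<^sub>0" using nonpos_Ints_nonpos[of "1 / 2 :: real"] by auto
    then show ?thesis using Gamma_plus1[of "1 / 2 :: real"] Gamma_half by simp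
  qed
  have Gamma_lim: "((\<lambda>\<alpha>. Gamma (1 + \<alpha> / 2)) \<longlongrightarrow> sqrt pi / 2) (at_left 1)"
    "((\<lambda>\<alpha>. Gamma (1 - \<alpha> / 2)) \<longlongrightarrow> sqrt pi) (at_left 1)"
    using tendsto_Gamma[of "\<lambda>\<alpha>. 1 + \<alpha> / 2" "3 / 2 :: real" "at_left 1"]
      tendsto_Gamma[of "\<lambda>\<alpha>. 1 - \<alpha> / 2" "1 / 2 :: real" "at_left 1"]
    by (auto intro!: tendsto_eq_intros simp: Gamma_half Gamma_3_half)
  have ev: "\<forall>\<^sub>F \<alpha> in at_left (1::real). 0 < \<alpha> \<and> \<alpha> < 1"
    using eventually_at_left_real[of 0 "1::real"] by simp

  have hyp_lim: "((\<lambda>\<alpha>. D * Gamma (1 + \<alpha> / 2) / (q0\<^sup>2 * Gamma (1 - \<alpha> / 2))) \<longlongrightarrow> D / (2 * q0\<^sup>2)) (at_left 1)"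
  proof -
    have "((\<lambda>\<alpha>. D * Gamma (1 + \<alpha> / 2) / (q0\<^sup>2 * Gamma (1 - \<alpha> / 2)))
        \<longlongrightarrow> D * (sqrt pi / 2) / (q0\<^sup>2 * sqrt pi)) (at_left 1)"
      using assms by (intro tendsto_intros Gamma_lim) auto
    then show ?thesis by (simp add: mult.commute)
  qed
  have K_1: "K 1 = D / (2 * q0\<^sup>2 * pi)"
    using assms by (simp add: K_def Gamma_half Gamma_3_half power3_eq_cube field_simps)
  have K_lim: "(K \<longlongrightarrow> K 1) (at_left 1)"
  proof -
    have "(K \<longlongrightarrow> D * (sqrt pi / 2) / (q0\<^sup>2 * sqrt pi ^ 3)) (at_left 1)"
      unfolding K_def[abs_def] using assms by (intro tendsto_intros Gamma_lim) auto
    moreover have "K 1 = D * (sqrt pi / 2) / (q0\<^sup>2 * sqrt pi ^ 3)"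
      by (simp add: K_def Gamma_half Gamma_3_half)
    ultimately show ?thesis by simp
  qed

  have profile: "concave_profile (f \<alpha>) (m \<alpha>) (n \<alpha>)" if "0 < \<alpha>" "\<alpha> \<le> 1" for \<alpha>
    using concave_profile_Wright[of "\<alpha> / 2"] that
    by (simp add: f_def[abs_def] m_def n_def[abs_def])
  have m_1: "m 1 x = exp (- (x\<^sup>2 / 4)) / sqrt pi" for x by (simp add: m_def Mainardi_half)
  have f_1: "f 1 x = erf (x / 2)" if "0 \<le> x" for x
    using one_minus_Wright_half[of "x / 2"] that by (simp add: f_def)

  \<comment> \<open>The argument varies together with \<alpha>, since f and m are later evaluated at
    the moving root.\<close>
  have f_lim: "((\<lambda>\<alpha>. f \<alpha> (y \<alpha>)) \<longlongrightarrow> f 1 y1) (at_left 1)" if "(y \<longlongrightarrow> y1) (at_left 1)" for y y1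
  proof -
    have "((\<lambda>\<alpha>. Wright (- y \<alpha>) (- (\<alpha> / 2)) 1) \<longlongrightarrow> Wright (- y1) (- (1 / 2)) 1) (at_left 1)"
      by (rule tendsto_Wright[OF at_left_nt])
        (use ev in \<open>auto intro!: tendsto_eq_intros that elim: eventually_mono\<close>)
    then show ?thesis unfolding f_def by (intro tendsto_diff) auto
  qed
  have m_lim: "((\<lambda>\<alpha>. m \<alpha> (y \<alpha>)) \<longlongrightarrow> m 1 y1) (at_left 1)" if "(y \<longlongrightarrow> y1) (at_left 1)" for y y1
    unfolding m_def Mainardi_def
    by (rule tendsto_Wright[OF at_left_nt])
      (use ev in \<open>auto intro!: tendsto_eq_intros that elim: eventually_mono\<close>)

  \<comment> \<open>K \<alpha> is the quotient in the data condition times m(0)^2 = 1/Gamma(1 -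
    \<alpha>/2)^2, so the condition is exactly what \<open>ex1_G\<close> asks for.\<close>
  have K_less: "K \<alpha> < (m \<alpha> 0)\<^sup>2"
    if "0 < \<alpha>" "\<alpha> \<le> 1" "D * Gamma (1 + \<alpha> / 2) / (q0\<^sup>2 * Gamma (1 - \<alpha> / 2)) < 1" for \<alpha>
  proof -
    have g: "0 < Gamma (1 - \<alpha> / 2)" using that by (intro Gamma_real_pos) auto
    have "m \<alpha> 0 = 1 / Gamma (1 - \<alpha> / 2)"
      using Wright_0[of "\<alpha> / 2" "1 - \<alpha> / 2"] that
      by (simp add: m_def Mainardi_def rGamma_inverse_Gamma inverse_eq_divide)
    moreover have "K \<alpha> = D * Gamma (1 + \<alpha> / 2) / (q0\<^sup>2 * Gamma (1 - \<alpha> / 2)) * (1 / Gamma (1 - \<alpha> / 2))\<^sup>2"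
      by (simp add: K_def power3_eq_cube power2_eq_square)
    moreover have "\<dots> < 1 * (1 / Gamma (1 - \<alpha> / 2))\<^sup>2"
      by (rule mult_strict_right_mono[OF that(3) zero_less_power[OF divide_pos_pos[OF zero_less_one g]]])
    ultimately show ?thesis by simp
  qed
  have K_pos: "0 < K \<alpha>" if "0 < \<alpha>" "\<alpha> \<le> 1" for \<alpha>
    unfolding K_def using that D assms by (intro divide_pos_pos mult_pos_pos Gamma_real_pos zero_less_power) auto

  \<comment> \<open>Roots of the fractional and the classical equation\<close>
  define root where "root \<alpha> x \<longleftrightarrow> 0 < x \<and> f \<alpha> x / x = K \<alpha> * (1 / m \<alpha> x)" for \<alpha> x
  have root_iff: "root \<alpha> x \<longleftrightarrow> 0 < x \<and> concave_profile.G (f \<alpha>) (m \<alpha>) x = K \<alpha>"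
    if "0 < \<alpha>" "\<alpha> \<le> 1" for \<alpha> x
    using concave_profile.equation_iff[OF profile[OF that] _ K_pos[OF that]] by (auto simp: root_def)
  have ex1_root: "\<exists>!x. root \<alpha> x"
    if "0 < \<alpha>" "\<alpha> \<le> 1" "D * Gamma (1 + \<alpha> / 2) / (q0\<^sup>2 * Gamma (1 - \<alpha> / 2)) < 1" for \<alpha>
    using concave_profile.ex1_G[OF profile[OF that(1,2)] K_pos[OF that(1,2)] K_less[OF that]]
    by (simp add: root_iff[OF that(1,2)])
  have ev_hyp: "\<forall>\<^sub>F \<alpha> in at_left 1. 0 < \<alpha> \<and> \<alpha> < 1 \<and> D * Gamma (1 + \<alpha> / 2) / (q0\<^sup>2 * Gamma (1 - \<alpha> / 2)) < 1"
    using ev order_tendstoD(2)[OF hyp_lim D(2)] by eventually_elim auto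

  have inv_m_1: "1 / m 1 (2 * x) = sqrt pi * exp (x\<^sup>2)" for x
    by (simp add: m_1 exp_minus power_mult_distrib field_simps)
  \<comment> \<open>The factor 2 matches f(2x) = erf x at \<alpha> = 1, so the fractional root tends
    to 2\<mu>.\<close>
  have root_1: "root 1 (2 * x) \<longleftrightarrow> 0 < x \<and> exp (x\<^sup>2) = q0\<^sup>2 * sqrt pi / D * (erf x / x)" for x
  proof (cases "0 < x")
    case True
    have "root 1 (2 * x) \<longleftrightarrow> erf x / (2 * x) = D / (2 * q0\<^sup>2 * pi) * (sqrt pi * exp (x\<^sup>2))"
      unfolding root_def inv_m_1 K_1 using True by (simp add: f_1)
    also have "D / (2 * q0\<^sup>2 * pi) * (sqrt pi * exp (x\<^sup>2)) = D / (2 * q0\<^sup>2 * sqrt pi) * exp (x\<^sup>2)"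
    proof -
      have "D / (2 * q0\<^sup>2 * P) * (p * exp (x\<^sup>2)) = D / (2 * q0\<^sup>2 * p) * exp (x\<^sup>2)"
        if "P = p * p" "p \<noteq> 0" for P p using that(2) unfolding that(1) by simp
      from this[of pi "sqrt pi"] show ?thesis by simp
    qed
    also have "erf x / (2 * x) = D / (2 * q0\<^sup>2 * sqrt pi) * exp (x\<^sup>2)
        \<longleftrightarrow> exp (x\<^sup>2) = q0\<^sup>2 * sqrt pi / D * (erf x / x)"
      using True D assms by (auto simp: field_simps)
    finally show ?thesis using True by simp
  qed (simp add: root_def)
  have ex1_root_1: "\<exists>!x. root 1 x"
    by (rule ex1_root) (use D assms in \<open>simp_all add: Gamma_half Gamma_3_half\<close>)
  define y where "y = (THE x. root 1 x)"
  have y: "root 1 y" unfolding y_def by (rule theI'[OF ex1_root_1])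
  have y_unique: "z = y" if "root 1 z" for z
    unfolding y_def by (rule the1_equality[OF ex1_root_1 that, symmetric])
  have ex1_classical: "\<exists>!x. 0 < x \<and> exp (x\<^sup>2) = q0\<^sup>2 * sqrt pi / D * (erf x / x)"
    unfolding root_1[symmetric]
  proof (rule ex1I)
    show "root 1 (2 * (y / 2))" using y by simp
    fix z assume "root 1 (2 * z)"
    then show "z = y / 2" using y_unique[of "2 * z"] by simp
  qed
  have \<mu>: "0 < \<mu>" "exp (\<mu>\<^sup>2) = q0\<^sup>2 * sqrt pi / D * (erf \<mu> / \<mu>)"
    using theI'[OF ex1_classical] by (simp_all add: \<mu>_def mu_1_def D_def)
  then have root_\<mu>: "root 1 (2 * \<mu>)" by (simp add: root_1)
  have erf_\<mu>: "0 < erf \<mu>"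
    using concave_profile.f_pos[OF profile[of 1], of "2 * \<mu>"] \<mu> by (simp add: f_1)

  have \<xi>_eq: "\<xi> \<alpha> = (THE x. root \<alpha> x)" for \<alpha>
    by (simp add: \<xi>_def xi_alpha_def root_def f_def m_def K_def D_def)
  have \<xi>_lim: "(\<xi> \<longlongrightarrow> 2 * \<mu>) (at_left 1)"
  proof (rule tendsto_profile_root[where fs = f and ms = m and ns = n and K = K and ?K0.0 = "K 1",
        OF profile[of 1]])
    show "concave_profile.G (f 1) (m 1) (2 * \<mu>) = K 1" "0 < 2 * \<mu>"
      using root_\<mu> root_iff[of 1] by auto
    show "\<forall>\<^sub>F \<alpha> in at_left 1. concave_profile (f \<alpha>) (m \<alpha>) (n \<alpha>) \<and> 0 < \<xi> \<alpha>
        \<and> concave_profile.G (f \<alpha>) (m \<alpha>) (\<xi> \<alpha>) = K \<alpha>"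
      using ev_hyp
    proof eventually_elim
      case (elim \<alpha>)
      then have \<alpha>: "0 < \<alpha>" "\<alpha> \<le> 1" by auto
      have "root \<alpha> (\<xi> \<alpha>)" unfolding \<xi>_eq using elim by (intro theI'[OF ex1_root] \<alpha>) blast
      then show ?case unfolding root_iff[OF \<alpha>] using profile[OF \<alpha>] by blast
    qed
  qed (use K_pos[of 1] K_lim f_lim m_lim in auto)

  \<comment> \<open>Limits of the coefficient, the free boundary and the temperature\<close>
  have c_lim: "((\<lambda>\<alpha>. c_alpha k \<rho> L T0 Tm q0 \<alpha>) \<longlongrightarrow> c_1 k \<rho> L T0 Tm q0) (at_left 1)"
  proof -
    have "((\<lambda>\<alpha>. L * Gamma (1 + \<alpha> / 2) / ((T0 - Tm) * Gamma (1 - \<alpha> / 2)) * (\<xi> \<alpha> * (1 / m \<alpha> (\<xi> \<alpha>))) * f \<alpha> (\<xi> \<alpha>))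
        \<longlongrightarrow> L * (sqrt pi / 2) / ((T0 - Tm) * sqrt pi) * (2 * \<mu> * (1 / m 1 (2 * \<mu>))) * f 1 (2 * \<mu>)) (at_left 1)"
      using assms by (intro tendsto_intros Gamma_lim m_lim f_lim \<xi>_lim) (auto simp: m_1)
    also have "L * (sqrt pi / 2) / ((T0 - Tm) * sqrt pi) * (2 * \<mu> * (1 / m 1 (2 * \<mu>))) * f 1 (2 * \<mu>)
        = L / (T0 - Tm) * (\<mu> * sqrt pi * exp (\<mu>\<^sup>2)) * erf \<mu>"
    proof -
      have "L * (sqrt pi / 2) / (d * sqrt pi) * (2 * \<mu> * z) = L / d * (\<mu> * z)" for d z by simp
      then show ?thesis unfolding inv_m_1 using \<mu>(1) by (simp only: mult.assoc) (simp add: f_1)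
    qed
    \<comment> \<open>The classical equation for \<mu> removes the exponential and supplies the
      second factor erf \<mu> in \<open>c_1\<close>.\<close>
    also have "\<mu> * sqrt pi * exp (\<mu>\<^sup>2) = pi * q0\<^sup>2 / D * erf \<mu>"
      unfolding \<mu>(2) using \<mu>(1) real_sqrt_mult_self[of pi] by (simp add: field_simps)
    also have "L / (T0 - Tm) * (pi * q0\<^sup>2 / D * erf \<mu>) * erf \<mu> = c_1 k \<rho> L T0 Tm q0"
      using assms by (simp add: c_1_def D_def power2_eq_square mult_ac flip: \<mu>_def)
    finally show ?thesis
      unfolding c_alpha_def Let_def by (simp add: \<xi>_def m_def f_def)
  qed
  have c_pos: "0 < c_1 k \<rho> L T0 Tm q0"
    using assms erf_\<mu> by (simp add: c_1_def flip: \<mu>_def)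
  have lambda_1: "lambda_1 k \<rho> L T0 Tm q0 = k * (T0 - Tm) / (q0 * sqrt pi * erf \<mu>)"
  proof -
    have "k / (\<rho> * c_1 k \<rho> L T0 Tm q0) = (k * (T0 - Tm) / (q0 * sqrt pi * erf \<mu>))\<^sup>2"
      using assms erf_\<mu> by (simp add: c_1_def field_simps power2_eq_square flip: \<mu>_def)
    moreover have "0 \<le> k * (T0 - Tm) / (q0 * sqrt pi * erf \<mu>)" using assms erf_\<mu> by simp
    ultimately show ?thesis unfolding lambda_1_def by (simp only: real_sqrt_unique)
  qed
  have lambda_pos: "0 < lambda_1 k \<rho> L T0 Tm q0" using lambda_1 assms erf_\<mu> by simp
  have lambda_lim: "(lambda_alpha k \<rho> L T0 Tm q0 \<longlongrightarrow> lambda_1 k \<rho> L T0 Tm q0) (at_left 1)"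
    unfolding lambda_alpha_def[abs_def] lambda_1_def
    using assms c_pos by (intro tendsto_intros c_lim) auto
  have powr_lim: "((\<lambda>\<alpha>. t powr (\<alpha> / 2)) \<longlongrightarrow> sqrt t) (at_left 1)" if "0 < t" for t :: real
    using that by (auto intro!: tendsto_eq_intros simp: powr_half_sqrt)
  have s_lim: "((\<lambda>\<alpha>. s_alpha k \<rho> L T0 Tm q0 \<alpha> t) \<longlongrightarrow> s_1 k \<rho> L T0 Tm q0 t) (at_left 1)" if "0 < t" for t
    unfolding s_alpha_def s_1_def \<xi>_def[symmetric] \<mu>_def[symmetric]
    using tendsto_mult[OF tendsto_mult[OF lambda_lim \<xi>_lim] powr_lim[OF that]] by (simp add: mult_ac)
  have T_lim: "((\<lambda>\<alpha>. T_alpha k \<rho> L T0 Tm q0 \<alpha> x t) \<longlongrightarrow> T_1 k \<rho> L T0 Tm q0 x t) (at_left 1)"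
    if "0 < t" "0 \<le> x" for t x
  proof -
    let ?l = "lambda_1 k \<rho> L T0 Tm q0"
    have "((\<lambda>\<alpha>. T0 - (T0 - Tm) / f \<alpha> (\<xi> \<alpha>) * f \<alpha> (x / (lambda_alpha k \<rho> L T0 Tm q0 \<alpha> * t powr (\<alpha> / 2))))
        \<longlongrightarrow> T0 - (T0 - Tm) / f 1 (2 * \<mu>) * f 1 (x / (?l * sqrt t))) (at_left 1)"
      using that lambda_pos \<mu> erf_\<mu>
      by (intro tendsto_intros f_lim \<xi>_lim lambda_lim powr_lim) (auto simp: f_1)
    also have "T0 - (T0 - Tm) / f 1 (2 * \<mu>) * f 1 (x / (?l * sqrt t)) = T_1 k \<rho> L T0 Tm q0 x t"
      using that lambda_pos \<mu> by (simp add: f_1 T_1_def mult_ac flip: \<mu>_def)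
    finally show ?thesis unfolding T_alpha_def by (simp add: f_def \<xi>_def)
  qed
  have "\<forall>\<^sub>F \<alpha> in at_left 1. D * Gamma (1 + \<alpha> / 2) / (q0\<^sup>2 * Gamma (1 - \<alpha> / 2)) < 1
      \<and> (\<exists>!x. 0 < x \<and> (1 - Wright (- x) (- \<alpha> / 2) 1) / x
            = D * Gamma (1 + \<alpha> / 2) / (q0\<^sup>2 * Gamma (1 - \<alpha> / 2) ^ 3) * (1 / Mainardi (\<alpha> / 2) x))"
    using ev_hyp
  proof eventually_elim
    case (elim \<alpha>)
    then show ?case using ex1_root[of \<alpha>] unfolding root_def f_def m_def K_def by auto
  qed
  then show ?thesis
    using hyp_lim ex1_classical lambda_1 c_lim s_lim T_lim unfolding D_def \<mu>_def by blast
qed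

end
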